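(* Let $\mathcal{A}$ be a contract automaton in the flow setting described in the context. Then $\mathcal{A}$ admits weak agreement if and only if the optimal value of the following problem is $\ge0$: maximise $\gamma$ subject to $\sum_{t_j\in T}a^i_{t_j}x_{t_j}\ge\gamma$ for all $i\in I_l$, $(x_{t_1},\ldots,x_{t_n})\in F_x$, $\gamma\in\mathbb{R}$.
   Context: Fix disjoint sets $\mathbb{R}$ (requests) and $\mathbb{O}$ (offers $\overline a$) and an idle symbol $\Box$; $\Sigma=\mathbb{R}\cup\mathbb{O}\cup\{\Box\}$, $co$ swaps $a$ and $\overline a$, fixes $\Box$. For $\vec v\in\Sigma^n$, $\vec v_{(i)}$ is its $i$-th entry. $\vec a\in\Sigma^n$ is a request (resp. offer) on $\alpha$ if $\vec a=\Box^{n_1}\alpha\Box^{n_2}$ with $\alpha\in\mathbb{R}$ (resp. $\mathbb{O}$), a match on $\alpha$ if $\vec a=\Box^{n_1}\alpha\Box^{n_2}co(\alpha)\Box^{n_3}$; $\vec a\bowtie\vec b$ iff $\vec a$ is a request or offer on some $\alpha$, and if an offer on $\alpha$ then $\vec b$ is a request on $co(\alpha)$, and if a request on $\alpha$ then $\vec b$ is an offer on $co(\alpha)$. A contract automaton (CA) of rank $r$ is $\langle Q,\vec q_0,A^r,A^o,T,F\rangle$, $Q=Q_1\times\cdots\times Q_r$ finite, $\vec q_0\in Q$, finite $A^r\subseteq\mathbb{R}$, $A^o\subseteq\mathbb{O}$, $F\subseteq Q$, $T\subseteq Q\times(A^r\cup A^o\cup\{\Box\})^r\times Q$ with labels requests,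 offers or matches and $\vec a_{(i)}=\Box\Rightarrow\vec q_{(i)}=\vec q'_{(i)}$. $\mathscr{L}(\mathcal{A})$: words of labels of paths from $\vec q_0$ to $F$. Observable of an action: the unique non-idle entry if it is a request or offer, $\tau$ if a match. $\mathfrak{W}$: words $w=\vec a_1\ldots\vec a_m\in(\Sigma^r)^*$, $r>1$, with a function $f:[1..m]\to[1..m]$ total and injective on the indices of request actions of $w$ and $f(i)=j$ only if $\vec a_i\bowtie\vec a_j$. $\mathcal{A}$ admits weak agreement iff $\mathscr{L}(\mathcal{A})\cap\mathfrak{W}\ne\emptyset$. Flow setting: $\mathcal{A}$ has a single final state $\vec q_f\ne\vec q_0$, every state is reachable from $\vec q_0$ and $\vec q_f$ is reachable from every state; $A^r=\{a^i\mid i\in I_l=\{1,\ldots,l\}\}$, $T=\{t_1,\ldots,t_n\}$. $FS(\vec q)$, $BS(\vec q)$: transitions leaving/entering $\vec q$. For states $\vec s,\vec d$, $F_{\vec s,\vec d}$ is the set of $(x_{t_1},\ldots,x_{t_n})\in\mathbb{N}^n$ for which there exist reals $z^{\vec q}_{t_i}$ ($\vec q\ne\vec s$, $t_i\in T$) with: for all $\vec q$, $\sum_{BS(\vec q)}x_{t_i}-\sum_{FS(\vec q)}x_{t_i}$ is $-1$ if $\vec q=\vec s$, $1$ if $\vec q=\vec d$, $0$ otherwise; $0\le z^{\vec q}_{t_i}\le x_{t_i}$ for all $\vec q\ne\vec s$, $t_i$; for all $\vec q\neq\vec s$ and $\vec q'$, $\sum_{BS(\vec q')}z^{\vec q}_{t_i}-\sum_{FS(\vec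 q')}z^{\vec q}_{t_i}$ is $-p^{\vec q}$ if $\vec q'=\vec s$, $p^{\vec q}$ if $\vec q'=\vec q$, $0$ otherwise, where $p^{\vec q}=1$ if $\sum_{FS(\vec q)}x_{t_i}>0$ and $0$ otherwise. $F_x=F_{\vec q_0,\vec q_f}$. For $t_j=(\vec q,\vec a,\vec q')$ and $i\in I_l$: $a^i_{t_j}=1$ if the observable of $\vec a$ is $\overline{a^i}$, $-1$ if it is $a^i$, $0$ otherwise.
   Formalization: The rank of the automaton is assumed to be greater than 1, since weak agreement words are only defined for r > 1; for rank 1 the claim fails, e.g. for a single offer transition from the initial to the final state. *)

theory Defs
  imports Complex_Main "HOL-Library.Extended_Real"
begin

text \<open>The type parameter is the set of action names: the requests are \<open>range Req\<close> and the
  offers are \<open>range Off\<close>, with \<open>Off a\<close> standing for the overlined name \<open>a\<close>.\<close>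

datatype 'a action = Req 'a | Off 'a | Idle

fun co :: "'a action \<Rightarrow> 'a action" where
  "co (Req a) = Off a"
| "co (Off a) = Req a"
| "co Idle = Idle"

type_synonym 'a label = "'a action list"

definition is_request :: "'a label \<Rightarrow> 'a action \<Rightarrow> bool" where
  "is_request v \<alpha> \<longleftrightarrow> \<alpha> \<in> range Req \<and>
     (\<exists>n1 n2. v = replicate n1 Idle @ [\<alpha>] @ replicate n2 Idle)"

definition is_offer :: "'a label \<Rightarrow> 'a action \<Rightarrow> bool" where
  "is_offer v \<alpha> \<longleftrightarrow> \<alpha> \<in> range Off \<and>
     (\<exists>n1 n2. v = replicate n1 Idle @ [\<alpha>] @ replicate n2 Idle)"

definition is_match :: "'a label \<Rightarrow> 'a action \<Rightarrow> bool" where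
  "is_match v \<alpha> \<longleftrightarrow> \<alpha> \<in> range Req \<union> range Off \<and>
     (\<exists>n1 n2 n3. v = replicate n1 Idle @ [\<alpha>] @ replicate n2 Idle @ [co \<alpha>] @ replicate n3 Idle)"

definition complementary :: "'a label \<Rightarrow> 'a label \<Rightarrow> bool"  (infix "\<bowtie>" 50) where
  "v \<bowtie> u \<longleftrightarrow> (\<exists>\<alpha>. (is_request v \<alpha> \<or> is_offer v \<alpha>) \<and>
     (is_offer v \<alpha> \<longrightarrow> is_request u (co \<alpha>)) \<and>
     (is_request v \<alpha> \<longrightarrow> is_offer u (co \<alpha>)))"

datatype 'a observable = Visible "'a action" | Tau

definition observable :: "'a label \<Rightarrow> 'a observable" where
  "observable v =
     (if \<exists>\<alpha>. is_request v \<alpha> \<or> is_offer v \<alpha>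
      then Visible (THE \<beta>. \<beta> \<in> set v \<and> \<beta> \<noteq> Idle) else Tau)"

type_synonym ('q, 'a) transition = "'q list \<times> 'a label \<times> 'q list"

text \<open>The field \<open>components\<close> lists the local state sets of the \<open>r\<close> principals; a state is a
  list of length \<open>r\<close>, an element of their product.\<close>

record ('q, 'a) contract_automaton =
  components :: "'q set list"
  initial :: "'q list"
  requests :: "'a action set"
  offers :: "'a action set"
  transitions :: "('q, 'a) transition set"
  finals :: "'q list set"

definition rank :: "('q, 'a) contract_automaton \<Rightarrow> nat" where
  "rank A = length (components A)"

definition states :: "('q, 'a) contract_automaton \<Rightarrow> 'q list set" where
  "states A = listset (components A)"

definition is_contract_automaton :: "('q, 'a) contract_automaton \<Rightarrow> bool" where
  "is_contract_automaton A \<longleftrightarrow>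
     finite (states A) \<and> initial A \<in> states A \<and> finals A \<subseteq> states A \<and>
     finite (requests A) \<and> requests A \<subseteq> range Req \<and>
     finite (offers A) \<and> offers A \<subseteq> range Off \<and>
     (\<forall>(q, v, q') \<in> transitions A.
        q \<in> states A \<and> q' \<in> states A \<and>
        length v = rank A \<and> set v \<subseteq> requests A \<union> offers A \<union> {Idle} \<and>
        (\<exists>\<alpha>. is_request v \<alpha> \<or> is_offer v \<alpha> \<or> is_match v \<alpha>) \<and>
        (\<forall>i < rank A. v ! i = Idle \<longrightarrow> q ! i = q' ! i))"

inductive path :: "('q, 'a) contract_automaton \<Rightarrow> 'q list \<Rightarrow> 'a label list \<Rightarrow> 'q list \<Rightarrow> bool"
  for A where
  path_Nil: "q \<in> states A \<Longrightarrow> path A q [] q"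
| path_Cons: "(q, v, q') \<in> transitions A \<Longrightarrow> path A q' w q'' \<Longrightarrow> path A q (v # w) q''"

definition language :: "('q, 'a) contract_automaton \<Rightarrow> 'a label list set" where
  "language A = {w. \<exists>q \<in> finals A. path A (initial A) w q}"

definition request_positions :: "'a label list \<Rightarrow> nat set" where
  "request_positions w = {i. i < length w \<and> (\<exists>\<alpha>. is_request (w ! i) \<alpha>)}"

text \<open>The matching \<open>f\<close> is a partial function on the positions of \<open>w\<close> (counted from 0) that is
  only required to be defined, and injective, on the requests.\<close>

definition weak_agreement_words :: "'a label list set" where
  "weak_agreement_words = {w. \<exists>r > 1. (\<forall>v \<in> set w. length v = r) \<and>
     (\<exists>f :: nat \<rightharpoonup> nat. dom f \<subseteq> {..<length w} \<and> ran f \<subseteq> {..<length w} \<and>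
        request_positions w \<subseteq> dom f \<and> inj_on f (request_positions w) \<and>
        (\<forall>i j. f i = Some j \<longrightarrow> w ! i \<bowtie> w ! j))}"

definition admits_weak_agreement :: "('q, 'a) contract_automaton \<Rightarrow> bool" where
  "admits_weak_agreement A \<longleftrightarrow> language A \<inter> weak_agreement_words \<noteq> {}"

definition flow_setting :: "('q, 'a) contract_automaton \<Rightarrow> 'q list \<Rightarrow> bool" where
  "flow_setting A qf \<longleftrightarrow> is_contract_automaton A \<and>
     finals A = {qf} \<and> qf \<noteq> initial A \<and>
     (\<forall>q \<in> states A. (\<exists>w. path A (initial A) w q) \<and> (\<exists>w. path A q w qf))"

definition FS :: "('q, 'a) contract_automaton \<Rightarrow> 'q list \<Rightarrow> ('q, 'a) transition set" where
  "FS A q = {t \<in> transitions A. fst t = q}"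

definition BS :: "('q, 'a) contract_automaton \<Rightarrow> 'q list \<Rightarrow> ('q, 'a) transition set" where
  "BS A q = {t \<in> transitions A. snd (snd t) = q}"

text \<open>Flows are indexed by the transitions themselves; values outside \<open>transitions A\<close> are
  irrelevant.\<close>

definition flows ::
  "('q, 'a) contract_automaton \<Rightarrow> 'q list \<Rightarrow> 'q list \<Rightarrow> (('q, 'a) transition \<Rightarrow> nat) set" where
  "flows A s d = {x. \<exists>z :: 'q list \<Rightarrow> ('q, 'a) transition \<Rightarrow> real.
     let p = (\<lambda>q. if (\<Sum>t\<in>FS A q. x t) > 0 then 1 else 0 :: real) in
     (\<forall>q \<in> states A.
        (\<Sum>t\<in>BS A q. real (x t)) - (\<Sum>t\<in>FS A q. real (x t)) =
          (if q = s then -1 else if q = d then 1 else 0)) \<and>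
     (\<forall>q \<in> states A - {s}. \<forall>t \<in> transitions A. 0 \<le> z q t \<and> z q t \<le> real (x t)) \<and>
     (\<forall>q \<in> states A - {s}. \<forall>q' \<in> states A.
        (\<Sum>t\<in>BS A q'. z q t) - (\<Sum>t\<in>FS A q'. z q t) =
          (if q' = s then - p q else if q' = q then p q else 0))}"

definition balance :: "'a action \<Rightarrow> ('q, 'a) transition \<Rightarrow> real" where
  "balance \<alpha> t =
     (if observable (fst (snd t)) = Visible (co \<alpha>) then 1
      else if observable (fst (snd t)) = Visible \<alpha> then -1 else 0)"

text \<open>The optimum is a supremum in the extended reals since the problem may be unbounded, for
  instance when the automaton has no requests or has a loop of offers.\<close>

definition optimal_value ::
  "('q, 'a) contract_automaton \<Rightarrow> 'q list \<Rightarrow> nat \<Rightarrow> (nat \<Rightarrow> 'a action) \<Rightarrow> ereal" where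
  "optimal_value A qf l a = Sup {ereal \<gamma> | \<gamma> x.
     x \<in> flows A (initial A) qf \<and>
     (\<forall>i \<in> {1..l}. (\<Sum>t\<in>transitions A. balance (a i) t * real (x t)) \<ge> \<gamma>)}"

end

theory Submission
  imports Defs "HOL-Library.Multiset"
begin

text \<open>A flow in \<open>F\<^sub>x\<close> is the same thing as the vector of transition counts of a run from the
  initial to the final state: conservation makes the multigraph with \<open>x t\<close> copies of each \<open>t\<close>
  balanced, the auxiliary flows \<open>z\<close> make its support reachable from the initial state (apply
  conservation of \<open>z q\<close> to the set of reachable states), and so an Eulerian trail exists.
  A word is in weak agreement iff every name is offered at least as often as it is requested.
  Since the constraint sums are integers, a supremum \<open>\<ge> 0\<close> forces some flow for which they are
  all \<open>\<ge> 0\<close>.\<close>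

subsection \<open>Eulerian trails\<close>

context
  fixes src tgt :: "'e \<Rightarrow> 'v"
begin

primrec walk :: "'v \<Rightarrow> 'e list \<Rightarrow> 'v \<Rightarrow> bool" where
  "walk u [] v \<longleftrightarrow> u = v"
| "walk u (e # p) v \<longleftrightarrow> src e = u \<and> walk (tgt e) p v"

text \<open>Vertex by vertex this is the degree condition for a trail from \<open>u\<close> to
  \<open>v\<close>, written additively to avoid subtraction. For \<open>u = v\<close> the extra
  element cancels and in-degree equals out-degree everywhere.\<close>

definition balanced :: "'e multiset \<Rightarrow> 'v \<Rightarrow> 'v \<Rightarrow> bool" where
  "balanced M u v \<longleftrightarrow> add_mset u (image_mset tgt M) = add_mset v (image_mset src M)"

definition edge_rel :: "'e set \<Rightarrow> ('v \<times> 'v) set" where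
  "edge_rel E = (\<lambda>e. (src e, tgt e)) ` E"

lemma walk_append: "walk u (p @ p') v \<longleftrightarrow> (\<exists>m. walk u p m \<and> walk m p' v)"
  by (induction p arbitrary: u) auto

lemma walk_balanced: "walk u p v \<Longrightarrow> balanced (mset p) u v"
proof (induction p arbitrary: u)
  case Nil
  then show ?case by (simp add: balanced_def)
next
  case (Cons e p)
  then have "balanced (mset p) (tgt e) v" "src e = u" by auto
  then show ?case by (simp add: balanced_def add_mset_commute)
qed

text \<open>The endpoint terms cancel, so the remainder has equal in- and out-degrees; it is
  therefore balanced from any vertex \<open>m\<close> to itself.\<close>

lemma balanced_diff:
  assumes "balanced M u v" "balanced N u v" "N \<subseteq># M"
  shows "balanced (M - N) m m"
proof -
  obtain K where M: "M = N + K" using assms(3) by (metis subset_mset.le_iff_add)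
  have "add_mset u (image_mset tgt N) + image_mset tgt K
      = add_mset v (image_mset src N) + image_mset src K"
    using assms(1) by (simp add: balanced_def M)
  moreover have "add_mset u (image_mset tgt N) = add_mset v (image_mset src N)"
    using assms(2) by (simp add: balanced_def)
  ultimately have "image_mset tgt K = image_mset src K" by simp
  then show ?thesis by (simp add: balanced_def M)
qed

lemma balanced_walk_from_edge:
  assumes "balanced M (src e) v" "e \<in># M"
  shows "\<exists>p. walk (src e) (e # p) v \<and> mset (e # p) \<subseteq># M"
  using assms
proof (induction "size M" arbitrary: M e)
  case 0
  then show ?case by simp
next
  case (Suc n)
  obtain N where M: "M = add_mset e N" using Suc.prems(2) by (metis insert_DiffM)
  have bal: "balanced N (tgt e) v"
    using Suc.prems(1) by (simp add: balanced_def M add_mset_commute)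
  show ?case
  proof (cases "tgt e = v")
    case True
    then show ?thesis by (intro exI[of _ "[]"]) (simp add: M)
  next
    case False
    have "tgt e \<in># add_mset v (image_mset src N)"
      using bal by (metis balanced_def union_single_eq_member)
    with False obtain e' where e': "e' \<in># N" "src e' = tgt e" by auto
    moreover have "n = size N" using Suc.hyps(2) by (simp add: M)
    ultimately obtain p where "walk (src e') (e' # p) v" "mset (e' # p) \<subseteq># N"
      using Suc.hyps(1)[of N e'] bal by auto
    then show ?thesis using e' by (intro exI[of _ "e' # p"]) (simp add: M)
  qed
qed

lemma balanced_walk:
  assumes "balanced M u v"
  shows "\<exists>p. walk u p v \<and> mset p \<subseteq># M"
proof (cases "u = v")
  case True
  then show ?thesis by (intro exI[of _ "[]"]) simp
next
  case False
  have "u \<in># add_mset v (image_mset src M)"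
    using assms by (metis balanced_def union_single_eq_member)
  with False obtain e where "e \<in># M" "src e = u" by auto
  then show ?thesis using balanced_walk_from_edge[of M e v] assms by blast
qed

theorem eulerian_trail:
  assumes bal: "balanced M u v"
    and conn: "\<And>e. e \<in># M \<Longrightarrow> (u, src e) \<in> (edge_rel (set_mset M))\<^sup>*"
  shows "\<exists>p. walk u p v \<and> mset p = M"
proof -
  let ?P = "\<lambda>p. walk u p v \<and> mset p \<subseteq># M"
  obtain p0 where p0: "?P p0" using balanced_walk[OF bal] by blast
  have bound: "\<forall>p. ?P p \<longrightarrow> length p < Suc (size M)"
    by (metis le_imp_less_Suc size_mset size_mset_mono)
  obtain p where p: "?P p" and max: "\<And>p'. ?P p' \<Longrightarrow> length p' \<le> length p"
    using ex_has_greatest_nat[of ?P p0 length "Suc (size M)"] p0 bound by blast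
  define N where "N = M - mset p"
  have M: "M = mset p + N" using p by (simp add: N_def)
  have "N = {#}"
  proof (rule ccontr)
    assume "N \<noteq> {#}"
    \<comment> \<open>The vertices visited by \<open>p\<close>; \<open>u\<close> is inserted
      separately because no edge of \<open>p\<close> need enter it.\<close>
    define V where "V = insert u (tgt ` set p)"
    have split: "\<exists>p1 p2. p = p1 @ p2 \<and> walk u p1 m \<and> walk m p2 v" if "m \<in> V" for m
    proof -
      have "\<exists>p1 p2. p = p1 @ p2 \<and> walk u p1 m"
      proof (cases "m = u")
        case True
        then show ?thesis by (intro exI[of _ "[]"] exI[of _ p]) simp
      next
        case False
        with that obtain e where e: "e \<in> set p" "tgt e = m" by (auto simp: V_def)
        then obtain p1 p2 where pp: "p = (p1 @ [e]) @ p2" by (metis append.assoc append_Cons append_Nil split_list)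
        then have "walk u (p1 @ [e]) m" using p e by (auto simp: walk_append)
        with pp show ?thesis by blast
      qed
      then obtain p1 p2 where p12: "p = p1 @ p2" "walk u p1 m" by blast
      moreover obtain m' where "walk u p1 m'" "walk m' p2 v" using p p12 by (auto simp: walk_append)
      moreover have "m' = m"
        using \<open>walk u p1 m'\<close> \<open>walk u p1 m\<close>
        by (induction p1 arbitrary: u) auto
      ultimately show ?thesis by blast
    qed
    have "\<exists>e. e \<in># N \<and> src e \<in> V"
    proof (rule ccontr)
      assume no: "\<nexists>e. e \<in># N \<and> src e \<in> V"
      have "m \<in> V" if "(u, m) \<in> (edge_rel (set_mset M))\<^sup>*" for m
        using that
      proof (induction rule: rtrancl_induct)
        case base
        then show ?case by (simp add: V_def)
      next
        case (step y z)
        then obtain e where e: "e \<in># M" "src e = y" "tgt e = z" by (auto simp: edge_rel_def)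
        then have "e \<in> set p" using no step.IH by (auto simp: M)
        then show ?case using e by (auto simp: V_def)
      qed
      moreover obtain e where "e \<in># N" using \<open>N \<noteq> {#}\<close> by blast
      ultimately show False using no conn[of e] by (auto simp: M)
    qed
    then obtain e where e: "e \<in># N" "src e \<in> V" by blast
    \<comment> \<open>Both \<open>M\<close> and \<open>p\<close> go from \<open>u\<close> to
      \<open>v\<close>, so a walk in the remainder that starts with \<open>e\<close> can be closed
      up at \<open>src e\<close>.\<close>
    have "balanced N (src e) (src e)"
      unfolding N_def using balanced_diff[OF bal] p walk_balanced by blast
    then obtain c where c: "walk (src e) (e # c) (src e)" "mset (e # c) \<subseteq># N"
      using balanced_walk_from_edge[of N e] e by blast
    obtain p1 p2 where p12: "p = p1 @ p2" "walk u p1 (src e)" "walk (src e) p2 v"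
      using split e(2) by blast
    have "walk u (p1 @ (e # c) @ p2) v" using p12 c(1) walk_append by blast
    moreover have "mset (p1 @ (e # c) @ p2) \<subseteq># M"
    proof -
      have "mset (p1 @ (e # c) @ p2) = mset p + mset (e # c)" by (simp add: p12)
      also have "\<dots> \<subseteq># M" unfolding M using c(2) by (intro subset_mset.add_left_mono)
      finally show ?thesis .
    qed
    ultimately show False using max[of "p1 @ (e # c) @ p2"] p12 by simp
  qed
  then show ?thesis using p M by auto
qed

section \<open>Degree balance as flow conservation\<close>

lemma count_image_mset_eq_sum:
  assumes "finite E" "set_mset M \<subseteq> E"
  shows "count (image_mset f M) q = (\<Sum>t\<in>{t \<in> E. f t = q}. count M t)"
  unfolding count_image_mset using assms
  by (intro sum.mono_neutral_left) (auto simp: not_in_iff)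

text \<open>Compares the two multisets count by count. The passage to reals makes the difference
  untruncated, and two separate indicators also cover \<open>u = v\<close>.\<close>

lemma balanced_iff_sum:
  assumes "finite E" "set_mset M \<subseteq> E"
  shows "balanced M u v \<longleftrightarrow> (\<forall>q. (\<Sum>t\<in>{t \<in> E. tgt t = q}. real (count M t))
      - (\<Sum>t\<in>{t \<in> E. src t = q}. real (count M t)) = of_bool (q = v) - of_bool (q = u))"
proof -
  have arith: "of_bool P + m = of_bool Q + n \<longleftrightarrow> real m - real n = of_bool Q - of_bool P"
    for P Q and m n :: nat
    by (cases P; cases Q) auto
  have "count (add_mset w N) q = of_bool (q = w) + count N q" for w N and q :: 'v
    by simp
  then have "balanced M u v \<longleftrightarrow> (\<forall>q. real (count (image_mset tgt M) q)
      - real (count (image_mset src M) q) = of_bool (q = v) - of_bool (q = u))"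
    by (simp only: balanced_def multiset_eq_iff arith)
  also have "\<dots> \<longleftrightarrow> (\<forall>q. (\<Sum>t\<in>{t \<in> E. tgt t = q}. real (count M t))
      - (\<Sum>t\<in>{t \<in> E. src t = q}. real (count M t)) = of_bool (q = v) - of_bool (q = u))"
    by (simp only: count_image_mset_eq_sum[OF assms] of_nat_sum)
  finally show ?thesis .
qed

text \<open>No flow leaves the reachable set, so a unit of flow cannot end outside it.\<close>

lemma unit_flow_reachable:
  fixes z :: "'e \<Rightarrow> real"
  assumes "finite E" "finite S" "u \<in> S" "src ` E \<subseteq> S" "tgt ` E \<subseteq> S"
    and nonneg: "\<And>t. t \<in> E \<Longrightarrow> 0 \<le> z t"
    and supp: "\<And>t. t \<in> E \<Longrightarrow> z t \<noteq> 0 \<Longrightarrow> t \<in> P"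
    and cons: "\<And>q. q \<in> S \<Longrightarrow> (\<Sum>t\<in>{t \<in> E. tgt t = q}. z t)
      - (\<Sum>t\<in>{t \<in> E. src t = q}. z t) = (if q = u then - 1 else if q = v then 1 else 0)"
  shows "(u, v) \<in> (edge_rel P)\<^sup>*"
proof (rule ccontr)
  assume v: "(u, v) \<notin> (edge_rel P)\<^sup>*"
  define R where "R = {q \<in> S. (u, q) \<in> (edge_rel P)\<^sup>*}"
  have finR: "finite R" and uR: "u \<in> R" using assms(2,3) by (auto simp: R_def)
  \<comment> \<open>Double counting: each edge is counted once, at the end selected by
    \<open>f\<close>.\<close>
  have group: "(\<Sum>q\<in>R. \<Sum>t\<in>{t \<in> E. f t = q}. z t) = (\<Sum>t\<in>{t \<in> E. f t \<in> R}. z t)"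
    for f :: "'e \<Rightarrow> 'v"
  proof -
    have "(\<Sum>q\<in>R. \<Sum>t\<in>{t \<in> E. f t = q}. z t)
        = (\<Sum>q\<in>R. \<Sum>t\<in>{t \<in> {t \<in> E. f t \<in> R}. f t = q}. z t)"
      by (intro sum.cong) auto
    also have "\<dots> = (\<Sum>t\<in>{t \<in> E. f t \<in> R}. z t)"
      using assms(1) finR by (intro sum.group) auto
    finally show ?thesis .
  qed
  \<comment> \<open>An edge with nonzero flow lies in \<open>P\<close>, so from \<open>R\<close> it
    leads back into \<open>R\<close>; the edges that leave \<open>R\<close> contribute zero.\<close>
  have "(\<Sum>t\<in>{t \<in> E. src t \<in> R}. z t) = (\<Sum>t\<in>{t \<in> E. src t \<in> R \<and> tgt t \<in> R}. z t)"
  proof (intro sum.mono_neutral_right ballI)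
    fix t assume t: "t \<in> {t \<in> E. src t \<in> R} - {t \<in> E. src t \<in> R \<and> tgt t \<in> R}"
    show "z t = 0"
    proof (rule ccontr)
      assume "z t \<noteq> 0"
      then have "(src t, tgt t) \<in> edge_rel P" using supp t by (auto simp: edge_rel_def)
      then have "tgt t \<in> R" using t assms(5) by (auto simp: R_def intro: rtrancl_into_rtrancl)
      then show False using t by auto
    qed
  qed (use assms(1) in auto)
  also have "\<dots> \<le> (\<Sum>t\<in>{t \<in> E. tgt t \<in> R}. z t)"
    using assms(1) nonneg by (intro sum_mono2) auto
  finally have "0 \<le> (\<Sum>q\<in>R. (\<Sum>t\<in>{t \<in> E. tgt t = q}. z t) - (\<Sum>t\<in>{t \<in> E. src t = q}. z t))"
    by (simp only: sum_subtractf group[of src] group[of tgt] diff_ge_0_iff_ge)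
  \<comment> \<open>Since \<open>v\<close> is outside \<open>R\<close>, conservation leaves only the
    \<open>- 1\<close> at \<open>u\<close>, against the nonnegative net inflow just shown.\<close>
  also have "\<dots> = (\<Sum>q\<in>R. if q = u then - 1 else 0)"
    using v by (intro sum.cong refl, subst cons) (auto simp: R_def)
  also have "\<dots> = - 1" using finR uR by simp
  finally show False by simp
qed

end

subsection \<open>Words in weak agreement\<close>

lemma is_request_set: "is_request v \<alpha> \<Longrightarrow> set v - {Idle} = {\<alpha>}"
  by (auto simp: is_request_def)

lemma is_offer_set: "is_offer v \<alpha> \<Longrightarrow> set v - {Idle} = {\<alpha>}"
  by (auto simp: is_offer_def)

lemma is_request_unique: "is_request v \<alpha> \<Longrightarrow> is_request v \<beta> \<Longrightarrow> \<alpha> = \<beta>"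
  by (metis is_request_set singleton_inject)

lemma is_offer_unique: "is_offer v \<alpha> \<Longrightarrow> is_offer v \<beta> \<Longrightarrow> \<alpha> = \<beta>"
  by (metis is_offer_set singleton_inject)

lemma is_request_not_is_offer: "is_request v \<alpha> \<Longrightarrow> \<not> is_offer v \<beta>"
  using is_request_set[of v \<alpha>] is_offer_set[of v \<beta>] by (auto simp: is_request_def is_offer_def)

text \<open>A request or offer has exactly one non-idle entry, so the definite description evaluates
  to it.\<close>

lemma observable_eq_Visible_iff:
  "observable v = Visible \<alpha> \<longleftrightarrow> is_request v \<alpha> \<or> is_offer v \<alpha>"
proof (cases "\<exists>\<beta>. is_request v \<beta> \<or> is_offer v \<beta>")
  case True
  then obtain \<beta> where \<beta>: "is_request v \<beta> \<or> is_offer v \<beta>" by blast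
  then have set: "set v - {Idle} = {\<beta>}" using is_request_set is_offer_set by blast
  then have "(THE \<gamma>. \<gamma> \<in> set v \<and> \<gamma> \<noteq> Idle) = \<beta>" by blast
  then have "observable v = Visible \<beta>" using True by (simp add: observable_def)
  then show ?thesis using \<beta> set is_request_set is_offer_set
    by (metis observable.inject singleton_inject)
next
  case False
  then show ?thesis by (auto simp: observable_def)
qed

text \<open>The name of a request is unique and a request is never an offer, so one of the two
  implications is vacuous and the witness is forced.\<close>

lemma request_complementary_iff:
  assumes "is_request v \<alpha>"
  shows "v \<bowtie> u \<longleftrightarrow> is_offer u (co \<alpha>)"
  using assms is_request_unique is_request_not_is_offer unfolding complementary_def by metis

definition request_count :: "'a action \<Rightarrow> 'a label list \<Rightarrow> nat" where
  "request_count \<alpha> w = length (filter (\<lambda>v. is_request v \<alpha>) w)"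

definition offer_count :: "'a action \<Rightarrow> 'a label list \<Rightarrow> nat" where
  "offer_count \<alpha> w = length (filter (\<lambda>v. is_offer v \<alpha>) w)"

lemma co_Req_inject: "\<alpha> \<in> range Req \<Longrightarrow> \<beta> \<in> range Req \<Longrightarrow> co \<alpha> = co \<beta> \<Longrightarrow> \<alpha> = \<beta>"
  by auto

text \<open>Requests on \<open>\<alpha>\<close> can only be sent to offers on
  \<open>co \<alpha>\<close>, and distinct request names use disjoint sets of offers. Hence an
  injective matching exists iff it exists for each name separately, which is a comparison of
  cardinalities.\<close>

lemma weak_agreement_words_iff:
  "w \<in> weak_agreement_words \<longleftrightarrow> (\<exists>r > 1. \<forall>v \<in> set w. length v = r) \<and>
     (\<forall>\<alpha>. request_count \<alpha> w \<le> offer_count (co \<alpha>) w)"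
proof -
  define R where "R \<alpha> = {i. i < length w \<and> is_request (w ! i) \<alpha>}" for \<alpha>
  define S where "S \<alpha> = {j. j < length w \<and> is_offer (w ! j) (co \<alpha>)}" for \<alpha>
  have fin: "finite (R \<alpha>)" "finite (S \<alpha>)" for \<alpha> by (auto simp: R_def S_def)
  have counts: "request_count \<alpha> w \<le> offer_count (co \<alpha>) w \<longleftrightarrow> card (R \<alpha>) \<le> card (S \<alpha>)" for \<alpha>
    by (simp add: request_count_def offer_count_def length_filter_conv_card R_def S_def)
  have "(\<exists>f :: nat \<rightharpoonup> nat. dom f \<subseteq> {..<length w} \<and> ran f \<subseteq> {..<length w} \<and>
        request_positions w \<subseteq> dom f \<and> inj_on f (request_positions w) \<and>
        (\<forall>i j. f i = Some j \<longrightarrow> w ! i \<bowtie> w ! j)) \<longleftrightarrow> (\<forall>\<alpha>. card (R \<alpha>) \<le> card (S \<alpha>))"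
    (is "(\<exists>f. ?M f) \<longleftrightarrow> ?C")
  proof
    assume "\<exists>f. ?M f"
    then obtain f where f: "ran f \<subseteq> {..<length w}" "request_positions w \<subseteq> dom f"
      "inj_on f (request_positions w)" "\<And>i j. f i = Some j \<Longrightarrow> w ! i \<bowtie> w ! j" by blast
    have R_pos: "R \<alpha> \<subseteq> request_positions w" for \<alpha> by (auto simp: R_def request_positions_def)
    show ?C
    proof
      fix \<alpha>
      have ex: "\<exists>j. f i = Some j \<and> j \<in> S \<alpha>" if i: "i \<in> R \<alpha>" for i
      proof -
        have "i \<in> dom f" using f(2) R_pos i by (meson subsetD)
        then obtain j where j: "f i = Some j" by blast
        then have "j < length w" using f(1) by (auto simp: ran_def)
        moreover have "is_offer (w ! j) (co \<alpha>)"
          using f(4)[OF j] i by (simp add: R_def request_complementary_iff[of _ \<alpha>])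
        ultimately show ?thesis using j by (simp add: S_def)
      qed
      \<comment> \<open>Stripping the option keeps injectivity because \<open>f\<close> is defined
        on all of \<open>R \<alpha>\<close>.\<close>
      have "inj_on (the \<circ> f) (R \<alpha>)"
      proof (rule inj_onI)
        fix i i' assume i: "i \<in> R \<alpha>" "i' \<in> R \<alpha>" "(the \<circ> f) i = (the \<circ> f) i'"
        moreover obtain j j' where "f i = Some j" "f i' = Some j'" using ex i(1,2) by blast
        ultimately have "f i = f i'" by simp
        moreover have "inj_on f (R \<alpha>)" using f(3) R_pos by (rule inj_on_subset)
        ultimately show "i = i'" using i(1,2) by (simp add: inj_on_def)
      qed
      moreover have "(the \<circ> f) ` R \<alpha> \<subseteq> S \<alpha>" using ex by force
      ultimately show "card (R \<alpha>) \<le> card (S \<alpha>)" using card_inj_on_le[OF _ _ fin(2)] by blast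
    qed
  next
    assume ?C
    then have "\<forall>\<alpha>. \<exists>g. g ` R \<alpha> \<subseteq> S \<alpha> \<and> inj_on g (R \<alpha>)" using card_le_inj[OF fin] by blast
    then obtain g where "\<forall>\<alpha>. g \<alpha> ` R \<alpha> \<subseteq> S \<alpha> \<and> inj_on (g \<alpha>) (R \<alpha>)"
      by (rule choice[THEN exE])
    then have g: "g \<alpha> ` R \<alpha> \<subseteq> S \<alpha>" "inj_on (g \<alpha>) (R \<alpha>)" for \<alpha> by auto
    \<comment> \<open>Each request position has one name, which selects the injection to apply
      there; the matching \<open>f\<close> glues these injections together.\<close>
    define name where "name i = (THE \<alpha>. is_request (w ! i) \<alpha>)" for i
    have name: "i \<in> R (name i)" "name i \<in> range Req" if i: "i \<in> request_positions w" for i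
    proof -
      obtain \<alpha> where \<alpha>: "is_request (w ! i) \<alpha>" "i < length w"
        using i by (auto simp: request_positions_def)
      then have "name i = \<alpha>" unfolding name_def
        by (intro the_equality) (rule \<alpha>(1), rule is_request_unique[OF _ \<alpha>(1)])
      then show "i \<in> R (name i)" "name i \<in> range Req"
        using \<alpha> by (auto simp: R_def is_request_def)
    qed
    \<comment> \<open>With \<open>None\<close> off the request positions, complementarity has to be
      checked at requests only.\<close>
    define f where "f i = (if i \<in> request_positions w then Some (g (name i) i) else None)" for i
    have gS: "g (name i) i \<in> S (name i)" if "i \<in> request_positions w" for i
      using subsetD[OF g(1) imageI[OF name(1)[OF that]]] .
    \<comment> \<open>A common value is an offer on the co-name of both positions, so the names
      coincide and the injectivity of a single \<open>g\<close> decides.\<close>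
    have "inj_on f (request_positions w)"
    proof (rule inj_onI)
      fix i i' assume i: "i \<in> request_positions w" "i' \<in> request_positions w" "f i = f i'"
      then have eq: "g (name i) i = g (name i') i'" unfolding f_def by simp
      have "is_offer (w ! g (name i) i) (co (name i))" using gS[OF i(1)] by (simp add: S_def)
      moreover have "is_offer (w ! g (name i) i) (co (name i'))"
        using gS[OF i(2)] by (simp add: S_def eq)
      ultimately have "co (name i) = co (name i')" by (rule is_offer_unique)
      then have same: "name i = name i'"
        by (rule co_Req_inject[OF name(2)[OF i(1)] name(2)[OF i(2)]])
      have "g (name i) i = g (name i) i'" using eq unfolding same .
      then show "i = i'"
      proof (rule inj_onD[OF g(2)])
        show "i \<in> R (name i)" using name(1)[OF i(1)] .
        show "i' \<in> R (name i)" using name(1)[OF i(2)] unfolding same .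
      qed
    qed
    moreover have "w ! i \<bowtie> w ! j \<and> j < length w \<and> i < length w" if "f i = Some j" for i j
    proof -
      have i: "i \<in> request_positions w" and j: "j = g (name i) i"
        using that by (auto simp: f_def split: if_splits)
      have "is_request (w ! i) (name i)" "is_offer (w ! j) (co (name i))" "j < length w" "i < length w"
        using name(1)[OF i] gS[OF i] j by (auto simp: R_def S_def)
      then show ?thesis using request_complementary_iff[of "w ! i" "name i"] by blast
    qed
    moreover from this have "dom f \<subseteq> {..<length w}" "ran f \<subseteq> {..<length w}"
      by (auto simp: dom_def ran_def)
    moreover have "request_positions w \<subseteq> dom f" by (auto simp: f_def)
    ultimately show "\<exists>f. ?M f" by (intro exI[of _ f]) simp
  qed
  then show ?thesis unfolding weak_agreement_words_def counts mem_Collect_eq by (simp only:) blast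
qed

subsection \<open>Runs and flows\<close>

abbreviation source :: "('q, 'a) transition \<Rightarrow> 'q list" where
  "source \<equiv> fst"

abbreviation target :: "('q, 'a) transition \<Rightarrow> 'q list" where
  "target \<equiv> \<lambda>t. snd (snd t)"

abbreviation label_of :: "('q, 'a) transition \<Rightarrow> 'a label" where
  "label_of \<equiv> \<lambda>t. fst (snd t)"

text \<open>A word forgets which transitions were taken; a flow counts transitions, so they are
  recovered here.\<close>

lemma path_imp_walk:
  "path A q w q' \<Longrightarrow> \<exists>p. walk source target q p q' \<and> set p \<subseteq> transitions A \<and> w = map label_of p"
proof (induction rule: path.induct)
  case (path_Nil q)
  then show ?case by (intro exI[of _ "[]"]) simp
next
  case (path_Cons q v q' w q'')
  then obtain p where "walk source target q' p q''" "set p \<subseteq> transitions A" "w = map label_of p"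
    by blast
  then show ?case using path_Cons.hyps by (intro exI[of _ "(q, v, q') # p"]) simp
qed

lemma walk_imp_path:
  assumes "is_contract_automaton A" "q \<in> states A"
    and "walk source target q p q'" "set p \<subseteq> transitions A"
  shows "path A q (map label_of p) q'"
  using assms(2-)
proof (induction p arbitrary: q)
  case Nil
  then show ?case by (simp add: path_Nil)
next
  case (Cons t p)
  obtain v q1 where t: "t = (q, v, q1)" using Cons.prems by (cases t) auto
  then have "(q, v, q1) \<in> transitions A" using Cons.prems by simp
  moreover from this have "q1 \<in> states A" using assms(1) by (auto simp: is_contract_automaton_def)
  ultimately show ?case using Cons.IH Cons.prems t by (auto intro: path_Cons)
qed

lemma transition_states:
  assumes "is_contract_automaton A" "t \<in> transitions A"
  shows "source t \<in> states A" "target t \<in> states A" "length (label_of t) = rank A"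
    "set (label_of t) \<subseteq> requests A \<union> offers A \<union> {Idle}"
proof -
  obtain q v q' where t: "t = (q, v, q')" by (cases t) auto
  have "\<forall>(q, v, q') \<in> transitions A. q \<in> states A \<and> q' \<in> states A \<and>
      length v = rank A \<and> set v \<subseteq> requests A \<union> offers A \<union> {Idle}"
    using assms(1) unfolding is_contract_automaton_def by fast
  then show "source t \<in> states A" "target t \<in> states A" "length (label_of t) = rank A"
      "set (label_of t) \<subseteq> requests A \<union> offers A \<union> {Idle}"
    using assms(2) unfolding t by auto
qed

lemma finite_transitions:
  assumes "is_contract_automaton A"
  shows "finite (transitions A)"
proof (rule finite_subset)
  let ?L = "{v. set v \<subseteq> requests A \<union> offers A \<union> {Idle} \<and> length v = rank A}"
  show "transitions A \<subseteq> states A \<times> ?L \<times> states A"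
    using transition_states[OF assms] by fastforce
  show "finite (states A \<times> ?L \<times> states A)"
    using assms by (intro finite_cartesian_product finite_lists_length_eq)
      (auto simp: is_contract_automaton_def)
qed

text \<open>Weighting by multiplicity amounts to summing \<open>balance \<alpha>\<close> along
  \<open>p\<close>, where each offer on \<open>co \<alpha>\<close> gives 1 and each request on
  \<open>\<alpha>\<close> gives -1.\<close>

lemma sum_balance_eq_counts:
  assumes "\<alpha> \<in> range Req" "finite T" "set p \<subseteq> T"
  shows "(\<Sum>t\<in>T. balance \<alpha> t * real (count (mset p) t))
    = real (offer_count (co \<alpha>) (map label_of p)) - real (request_count \<alpha> (map label_of p))"
proof -
  have bal: "balance \<alpha> t = of_bool (is_offer (label_of t) (co \<alpha>)) - of_bool (is_request (label_of t) \<alpha>)"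
    for t :: "('q, 'a) transition"
    using assms(1) is_request_not_is_offer[of "label_of t" \<alpha> "co \<alpha>"]
    by (auto simp: balance_def observable_eq_Visible_iff is_offer_def is_request_def)
  have "(\<Sum>t\<in>T. balance \<alpha> t * real (count (mset p) t)) = (\<Sum>t\<leftarrow>p. balance \<alpha> t)"
    using assms(3)
  proof (induction p)
    case (Cons t p)
    have "(\<Sum>s\<in>T. balance \<alpha> s * real (count (mset (t # p)) s))
        = (\<Sum>s\<in>T. (if s = t then balance \<alpha> t else 0) + balance \<alpha> s * real (count (mset p) s))"
      by (intro sum.cong) (auto simp: algebra_simps)
    also have "\<dots> = balance \<alpha> t + (\<Sum>s\<in>T. balance \<alpha> s * real (count (mset p) s))"
      using Cons.prems assms(2) by (simp add: sum.distrib)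
    finally show ?case using Cons by simp
  qed simp
  also have "\<dots> = real (offer_count (co \<alpha>) (map label_of p)) - real (request_count \<alpha> (map label_of p))"
    by (induction p) (auto simp: bal offer_count_def request_count_def)
  finally show ?thesis .
qed

section \<open>Flows as transition counts of runs\<close>

lemma walk_conservation:
  assumes "finite (transitions A)" "walk source target u p v" "set p \<subseteq> transitions A"
  shows "(\<Sum>t\<in>BS A q. real (count (mset p) t)) - (\<Sum>t\<in>FS A q. real (count (mset p) t))
    = of_bool (q = v) - of_bool (q = u)"
  using walk_balanced[OF assms(2)] balanced_iff_sum[OF assms(1), of "mset p" source target u v] assms(3)
  by (simp add: BS_def FS_def)

text \<open>Conservation of \<open>x\<close> is the degree balance of the walk. If the walk leaves
  \<open>q\<close>, its prefix up to that moment serves as the unit flow \<open>z q\<close>;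
  otherwise the zero flow does.\<close>

lemma walk_count_in_flows:
  assumes "finite (transitions A)" "walk source target s p d" "set p \<subseteq> transitions A" "s \<noteq> d"
  shows "count (mset p) \<in> flows A s d"
proof -
  let ?x = "count (mset p)"
  have "\<exists>y. (\<forall>t. 0 \<le> y t \<and> y t \<le> real (?x t)) \<and>
      (\<forall>q'. (\<Sum>t\<in>BS A q'. y t) - (\<Sum>t\<in>FS A q'. y t)
        = (if q' = s then - P else if q' = q then P else 0))"
    if q: "q \<noteq> s" and P: "P = (if (\<Sum>t\<in>FS A q. ?x t) > 0 then 1 else 0)" for q and P :: real
  proof (cases "(\<Sum>t\<in>FS A q. ?x t) > 0")
    case False
    then show ?thesis by (intro exI[of _ "\<lambda>_. 0"]) (simp add: P)
  next
    case True
    then obtain t where t: "t \<in> FS A q" "?x t > 0"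
      by (metis gr_zeroI less_irrefl sum.neutral)
    then have "t \<in> set p" by (metis count_greater_zero_iff set_mset_mset)
    then obtain p1 p2 where p: "p = p1 @ t # p2" by (meson split_list)
    have w: "walk source target s p1 q"
      using assms(2) t by (auto simp: p walk_append FS_def)
    have "set p1 \<subseteq> transitions A" using assms(3) p by simp
    \<comment> \<open>The counts of a prefix are bounded by those of \<open>p\<close>, which gives
      \<open>z \<le> x\<close>.\<close>
    then show ?thesis using walk_conservation[OF assms(1) w] q True
      by (intro exI[of _ "\<lambda>t. real (count (mset p1) t)"]) (simp add: P p)
  qed
  then have "\<forall>q. \<exists>y. q \<noteq> s \<longrightarrow> (\<forall>t. 0 \<le> y t \<and> y t \<le> real (?x t)) \<and>
      (\<forall>q'. (\<Sum>t\<in>BS A q'. y t) - (\<Sum>t\<in>FS A q'. y t)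
        = (if q' = s then - (if (\<Sum>t\<in>FS A q. ?x t) > 0 then 1 else 0)
           else if q' = q then (if (\<Sum>t\<in>FS A q. ?x t) > 0 then 1 else 0) else 0))"
    by blast
  then obtain z where z: "\<forall>q. q \<noteq> s \<longrightarrow> (\<forall>t. 0 \<le> z q t \<and> z q t \<le> real (?x t)) \<and>
      (\<forall>q'. (\<Sum>t\<in>BS A q'. z q t) - (\<Sum>t\<in>FS A q'. z q t)
        = (if q' = s then - (if (\<Sum>t\<in>FS A q. ?x t) > 0 then 1 else 0)
           else if q' = q then (if (\<Sum>t\<in>FS A q. ?x t) > 0 then 1 else 0) else 0))"
    by (elim choice[THEN exE])
  have "\<forall>q. (\<Sum>t\<in>BS A q. real (?x t)) - (\<Sum>t\<in>FS A q. real (?x t))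
      = (if q = s then - 1 else if q = d then 1 else 0)"
    using walk_conservation[OF assms(1-3)] assms(4) by auto
  then show ?thesis unfolding flows_def Let_def using z by (intro CollectI exI[of _ z]) (simp del: split_paired_All)
qed

text \<open>The walk is an Eulerian trail of the multigraph \<open>M\<close> with \<open>x t\<close>
  copies of each transition \<open>t\<close>; conservation gives balance, and the auxiliary flows
  give connectedness.\<close>

lemma flow_imp_walk:
  assumes A: "is_contract_automaton A" and sd: "s \<in> states A" "d \<in> states A" "s \<noteq> d"
    and x: "x \<in> flows A s d"
  shows "\<exists>p. walk source target s p d \<and> set p \<subseteq> transitions A \<and>
    (\<forall>t \<in> transitions A. count (mset p) t = x t)"
proof -
  let ?T = "transitions A"
  have fin: "finite ?T" using finite_transitions[OF A] .
  define M where "M = (\<Sum>t\<in>?T. replicate_mset (x t) t)"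
  have cM: "count M t = (if t \<in> ?T then x t else 0)" for t
    unfolding M_def using fin by (simp add: count_sum)
  have M_sub: "set_mset M \<subseteq> ?T" using cM by (auto simp flip: count_greater_zero_iff split: if_splits)
  have M_mem: "t \<in># M \<longleftrightarrow> t \<in> ?T \<and> x t > 0" for t
    using cM[of t] by (auto simp flip: count_greater_zero_iff)
  from x obtain z where
    "\<forall>q \<in> states A. (\<Sum>t\<in>BS A q. real (x t)) - (\<Sum>t\<in>FS A q. real (x t)) =
        (if q = s then - 1 else if q = d then 1 else 0)" and
    "\<forall>q \<in> states A - {s}. \<forall>t \<in> ?T. 0 \<le> z q t \<and> z q t \<le> real (x t)" and
    "\<forall>q \<in> states A - {s}. \<forall>q' \<in> states A.
        (\<Sum>t\<in>BS A q'. z q t) - (\<Sum>t\<in>FS A q'. z q t) =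
          (if q' = s then - (if (\<Sum>t\<in>FS A q. x t) > 0 then 1 else 0)
           else if q' = q then (if (\<Sum>t\<in>FS A q. x t) > 0 then 1 else 0) else 0)"
    unfolding flows_def Let_def mem_Collect_eq by - (elim exE conjE, rule that)
  note cons = this(1)[rule_format] and zx = this(2)[rule_format] and zc = this(3)[rule_format]
  have "balanced source target M s d"
    unfolding balanced_iff_sum[OF fin M_sub]
  proof
    fix q
    have "(\<Sum>t\<in>BS A q. real (x t)) - (\<Sum>t\<in>FS A q. real (x t)) = of_bool (q = d) - of_bool (q = s)"
    proof (cases "q \<in> states A")
      case True
      then show ?thesis using cons sd(3) by auto
    next
      \<comment> \<open>Conservation is given at states only, while balance concerns every vertex;
        off the states there are no transitions and neither endpoint.\<close>
      case False
      then have "BS A q = {}" "FS A q = {}"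
        using transition_states[OF A] by (auto simp: BS_def FS_def)
      then show ?thesis using False sd by auto
    qed
    then show "(\<Sum>t\<in>{t \<in> ?T. target t = q}. real (count M t))
        - (\<Sum>t\<in>{t \<in> ?T. source t = q}. real (count M t)) = of_bool (q = d) - of_bool (q = s)"
      by (simp add: BS_def FS_def cM)
  qed
  moreover have "(s, source t) \<in> (edge_rel source target (set_mset M))\<^sup>*" if t: "t \<in># M" for t
  proof (cases "source t = s")
    case False
    let ?q = "source t"
    have q: "?q \<in> states A - {s}" using False t M_mem transition_states[OF A] by auto
    have "t \<in> FS A ?q" "x t > 0" using t M_mem by (auto simp: FS_def)
    moreover have "finite (FS A ?q)" using fin by (simp add: FS_def)
    \<comment> \<open>The flow leaves \<open>source t\<close>, so the indicator in its constraint is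
      1 and \<open>z ?q\<close> is a genuine unit flow from \<open>s\<close> to it.\<close>
    ultimately have pos: "(\<Sum>t\<in>FS A ?q. x t) > 0" by (metis gr_zeroI less_irrefl sum_eq_0_iff)
    show ?thesis
    proof (rule unit_flow_reachable[where E = ?T and S = "states A" and z = "z ?q"])
      show "finite (states A)" using A by (simp add: is_contract_automaton_def)
      show "0 \<le> z ?q t'" if "t' \<in> ?T" for t' using zx[OF q that] by simp
      \<comment> \<open>Here the capacity bound \<open>z \<le> x\<close> enters: a transition
        carrying auxiliary flow has a copy in \<open>M\<close>.\<close>
      show "t' \<in> set_mset M" if "t' \<in> ?T" "z ?q t' \<noteq> 0" for t'
        using zx[OF q that(1)] that by (auto simp: M_mem)
      show "(\<Sum>t\<in>{t \<in> ?T. target t = q'}. z ?q t) - (\<Sum>t\<in>{t \<in> ?T. source t = q'}. z ?q t)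
          = (if q' = s then - 1 else if q' = ?q then 1 else 0)" if "q' \<in> states A" for q'
        using zc[OF q that] pos by (simp add: BS_def FS_def)
    qed (use fin sd transition_states[OF A] in auto)
  qed simp
  ultimately obtain p where "walk source target s p d" "mset p = M"
    using eulerian_trail[of source target M s d] by blast
  moreover from this have "set p \<subseteq> ?T" using M_sub by (metis set_mset_mset)
  ultimately show ?thesis using cM by auto
qed

text \<open>Reduces the counting criterion, which ranges over all names, to the names in
  \<open>requests A\<close>, since no other request can occur on a transition. The rank supplies the
  common label length, even for the empty word.\<close>

lemma map_label_of_weak_agreement_iff:
  assumes A: "is_contract_automaton A" "rank A > 1" and p: "set p \<subseteq> transitions A"
  shows "map label_of p \<in> weak_agreement_words \<longleftrightarrow>
    (\<forall>\<alpha> \<in> requests A. (\<Sum>t\<in>transitions A. balance \<alpha> t * real (count (mset p) t)) \<ge> 0)"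
proof -
  let ?w = "map label_of p"
  have "\<exists>r > 1. \<forall>v \<in> set ?w. length v = r"
    using A(2) p transition_states(3)[OF A(1)] by (intro exI[of _ "rank A"]) auto
  moreover have "request_count \<alpha> ?w = 0" if "\<alpha> \<notin> requests A" for \<alpha>
  proof -
    have "\<not> is_request (label_of t) \<alpha>" if t: "t \<in> set p" for t
    proof
      assume r: "is_request (label_of t) \<alpha>"
      then have "\<alpha> \<in> requests A \<union> offers A \<union> {Idle}"
        using is_request_set[OF r] transition_states(4)[OF A(1), of t] p t by blast
      moreover have "\<alpha> \<in> range Req" using r by (simp add: is_request_def)
      moreover have "offers A \<subseteq> range Off" using A(1) by (simp add: is_contract_automaton_def)
      ultimately show False using \<open>\<alpha> \<notin> requests A\<close> by auto
    qed
    then show ?thesis by (auto simp: request_count_def filter_empty_conv)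
  qed
  ultimately have "?w \<in> weak_agreement_words \<longleftrightarrow>
      (\<forall>\<alpha> \<in> requests A. request_count \<alpha> ?w \<le> offer_count (co \<alpha>) ?w)"
    unfolding weak_agreement_words_iff by (metis le0)
  also have "\<dots> \<longleftrightarrow>
      (\<forall>\<alpha> \<in> requests A. (\<Sum>t\<in>transitions A. balance \<alpha> t * real (count (mset p) t)) \<ge> 0)"
  proof (intro ball_cong refl)
    fix \<alpha> assume "\<alpha> \<in> requests A"
    then have "\<alpha> \<in> range Req" using A(1) by (auto simp: is_contract_automaton_def)
    from sum_balance_eq_counts[OF this finite_transitions[OF A(1)] p]
    show "request_count \<alpha> ?w \<le> offer_count (co \<alpha>) ?w \<longleftrightarrow>
        (\<Sum>t\<in>transitions A. balance \<alpha> t * real (count (mset p) t)) \<ge> 0" by simp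
  qed
  finally show ?thesis .
qed

section \<open>Integrality and the optimal value\<close>

lemma balance_sum_in_Ints: "(\<Sum>t\<in>T. balance \<alpha> t * real (x t)) \<in> \<int>"
  by (intro Ints_sum Ints_mult Ints_of_nat) (simp add: balance_def)

text \<open>The supremum may be infinite, so no optimal flow is assumed. A nonnegative supremum
  gives a feasible \<open>\<gamma> > -1\<close>, and integer sums exceeding -1 are nonnegative;
  conversely such a flow makes \<open>\<gamma> = 0\<close> feasible.\<close>

lemma optimal_value_nonneg_iff:
  "optimal_value A qf l a \<ge> 0 \<longleftrightarrow> (\<exists>x \<in> flows A (initial A) qf.
     \<forall>i \<in> {1..l}. (\<Sum>t\<in>transitions A. balance (a i) t * real (x t)) \<ge> 0)"
    (is "?L \<longleftrightarrow> ?R")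
proof
  assume ?L
  \<comment> \<open>The strict gap yields an actual feasible point; it also rules out an empty
    feasible set, whose supremum is minus infinity.\<close>
  then have "ereal (-1) < optimal_value A qf l a"
    by (rule less_le_trans[rotated]) simp
  then obtain y where "ereal (-1) < y" and y: "y \<in> {ereal \<gamma> | \<gamma> x. x \<in> flows A (initial A) qf \<and>
      (\<forall>i \<in> {1..l}. (\<Sum>t\<in>transitions A. balance (a i) t * real (x t)) \<ge> \<gamma>)}"
    unfolding optimal_value_def less_Sup_iff by (elim bexE)
  moreover obtain \<gamma> x where "y = ereal \<gamma>" "x \<in> flows A (initial A) qf"
    "\<forall>i \<in> {1..l}. (\<Sum>t\<in>transitions A. balance (a i) t * real (x t)) \<ge> \<gamma>"
    using y by (elim CollectE exE conjE)
  ultimately have x: "\<gamma> > -1" "x \<in> flows A (initial A) qf"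
    "\<And>i. i \<in> {1..l} \<Longrightarrow> (\<Sum>t\<in>transitions A. balance (a i) t * real (x t)) \<ge> \<gamma>"
    by simp_all
  have "(\<Sum>t\<in>transitions A. balance (a i) t * real (x t)) \<ge> 0" if i: "i \<in> {1..l}" for i
  proof -
    obtain k :: int where "(\<Sum>t\<in>transitions A. balance (a i) t * real (x t)) = of_int k"
      by (rule Ints_cases[OF balance_sum_in_Ints])
    then show ?thesis using x(1) x(3)[OF i] by simp
  qed
  then show ?R using x(2) by blast
next
  assume ?R
  then obtain x where "x \<in> flows A (initial A) qf"
    "\<forall>i \<in> {1..l}. (\<Sum>t\<in>transitions A. balance (a i) t * real (x t)) \<ge> 0" by (elim bexE)
  then show ?L unfolding optimal_value_def zero_ereal_def
    by (intro Sup_upper CollectI exI[of _ 0] exI[of _ x] conjI refl)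
qed

theorem theorem4p14:
  fixes A :: "('q, 'a) contract_automaton"
    and qf :: "'q list"
    and l :: nat
    and a :: "nat \<Rightarrow> 'a action"
  assumes "flow_setting A qf"
    and "rank A > 1"
    and "bij_betw a {1..l} (requests A)"
  shows "admits_weak_agreement A \<longleftrightarrow> optimal_value A qf l a \<ge> 0"
proof -
  have A: "is_contract_automaton A" and qf: "finals A = {qf}" "initial A \<noteq> qf"
    using assms(1) by (auto simp: flow_setting_def)
  then have st: "initial A \<in> states A" "qf \<in> states A" by (auto simp: is_contract_automaton_def)
  \<comment> \<open>The constraints indexed by \<open>{1..l}\<close> are thus the constraints over
    \<open>requests A\<close>.\<close>
  have req: "requests A = a ` {1..l}" using assms(3) by (simp add: bij_betw_def)
  show ?thesis
  proof
    assume "admits_weak_agreement A"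
    then obtain w where w: "path A (initial A) w qf" "w \<in> weak_agreement_words"
      by (auto simp: admits_weak_agreement_def language_def qf)
    obtain p where p: "walk source target (initial A) p qf" "set p \<subseteq> transitions A" "w = map label_of p"
      using path_imp_walk[OF w(1)] by blast
    have "count (mset p) \<in> flows A (initial A) qf"
      using walk_count_in_flows[OF finite_transitions[OF A] p(1,2) qf(2)] .
    then show "optimal_value A qf l a \<ge> 0"
      using map_label_of_weak_agreement_iff[OF A assms(2) p(2)] w(2) p(3) req
      by (auto simp: optimal_value_nonneg_iff)
  next
    assume "optimal_value A qf l a \<ge> 0"
    then obtain x where x: "x \<in> flows A (initial A) qf"
      "\<And>\<alpha>. \<alpha> \<in> requests A \<Longrightarrow> (\<Sum>t\<in>transitions A. balance \<alpha> t * real (x t)) \<ge> 0"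
      by (auto simp: optimal_value_nonneg_iff req)
    \<comment> \<open>The feasible flow is realized by a run with exactly these counts, so its word
      inherits the nonnegative balances.\<close>
    obtain p where p: "walk source target (initial A) p qf" "set p \<subseteq> transitions A"
      "\<forall>t \<in> transitions A. count (mset p) t = x t"
      using flow_imp_walk[OF A st qf(2) x(1)] by blast
    have "map label_of p \<in> weak_agreement_words"
      using map_label_of_weak_agreement_iff[OF A assms(2) p(2)] x(2) p(3) by simp
    moreover have "map label_of p \<in> language A"
      using walk_imp_path[OF A st(1) p(1,2)] by (simp add: language_def qf)
    ultimately show "admits_weak_agreement A" by (auto simp: admits_weak_agreement_def)
  qed
qed

end
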